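(* Let $b\in\mathbb N$ and $k,\ell,n\in\mathbb N_+$ be such that $b+\ell<n=b(k+1)+\ell k$, and set $a=n-b-\ell$. Then $g=((k+1)^{[b]},k^{[\ell]})$ belongs to $\mathcal J(\mathcal L_n)$ and is of type A if $b=0$ and of type B if $b\geq 1$; moreover $m=(a,1^{[b+\ell]})$ belongs to $\mathcal M(\mathcal L_n)$, and both $g\swarrow m$ and $g\nearrow m$ hold. Moreover, these are the only such $m$: if $g\in\mathcal J(\mathcal L_n)$ is of type A or type B and $m\in\mathcal M(\mathcal L_n)$ satisfies both $g\swarrow m$ and $g\nearrow m$, then there are $b\in\mathbb N$, $k,\ell\in\mathbb N_+$ with $b+\ell<n=b(k+1)+\ell k$ such that $g=((k+1)^{[b]},k^{[\ell]})$ and $m=(n-b-\ell,1^{[b+\ell]})$.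
   Context: $\mathbb N=\{0,1,2,\dots\}$, $\mathbb N_+=\mathbb N\setminus\{0\}$. A partition of $n\in\mathbb N$ is a tuple $(a_1,\dots,a_n)$ of natural numbers with $a_1\ge\dots\ge a_n\ge 0$ and $\sum a_i=n$; trailing zeros may be omitted or added. $x^{[s]}$ denotes $s$ consecutive entries equal to $x$ (no entry if $s=0$). $\mathcal L_n$ is the finite lattice of all partitions of $n$ under the dominance order: $a\le b$ iff $\sum_{i=1}^j a_i\le\sum_{i=1}^j b_i$ for all $1\le j\le n$. $\mathcal J(\mathcal L_n)$ is the set of (completely) join-irreducible elements (not the least element, and $x=y\vee z$ implies $x=y$ or $x=z$); $\mathcal M(\mathcal L_n)$ is the set of (completely) meet-irreducible elements (not the greatest element, and $x=y\wedge z$ implies $x=y$ or $x=z$). Arrow relations of the standard context $(\mathcal J(\mathcal L_n),\mathcal M(\mathcal L_n),\le)$: for $g\in\mathcal J(\mathcal L_n)$ and $m\in\mathcal M(\mathcal L_n)$ put $g'=\{y\in\mathcal M(\mathcal L_n): g\le y\}$ and $m'=\{y\in\mathcal J(\mathcal L_n): y\le m\}$. Then $g\swarrow m$ iff $g\nleq m$ and for all $h\in\mathcal J(\mathcal L_n)$ with $g'\subsetneq h'$ we have $h\le m$; and $g\nearrow m$ iff $g\nleq m$ and for all $y\in\mathcal M(\mathcal L_n)$ with $m'\subsetneq y'$ we have $g\le y$. Types of partitions of $n$ in $\mathcal J(\mathcal L_n)$: type A: $(k^{[\ell]})$ with $k\ge2$, $\ell\ge 1$; type B: $(k^{[b]},(k-1)^{[\ell]})$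 with $k\ge2$, $b,\ell\ge1$. *)

theory Defs
  imports "HOL-Algebra.Lattice"
begin

section \<open>Irreducible elements and arrow relations\<close>

definition join_irreducibles :: "('a, 'b) gorder_scheme \<Rightarrow> 'a set" where
  "join_irreducibles L = {x \<in> carrier L. \<not> least L x (carrier L) \<and>
     (\<forall>y \<in> carrier L. \<forall>z \<in> carrier L. x = y \<squnion>\<^bsub>L\<^esub> z \<longrightarrow> x = y \<or> x = z)}"

definition meet_irreducibles :: "('a, 'b) gorder_scheme \<Rightarrow> 'a set" where
  "meet_irreducibles L = {x \<in> carrier L. \<not> greatest L x (carrier L) \<and>
     (\<forall>y \<in> carrier L. \<forall>z \<in> carrier L. x = y \<sqinter>\<^bsub>L\<^esub> z \<longrightarrow> x = y \<or> x = z)}"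

text \<open>The derivations of single objects and attributes in the standard context of \<open>L\<close>, whose
  objects are the join-irreducibles and whose attributes are the meet-irreducibles.\<close>

definition obj_deriv :: "('a, 'b) gorder_scheme \<Rightarrow> 'a \<Rightarrow> 'a set" where
  "obj_deriv L g = {y \<in> meet_irreducibles L. g \<sqsubseteq>\<^bsub>L\<^esub> y}"

definition attr_deriv :: "('a, 'b) gorder_scheme \<Rightarrow> 'a \<Rightarrow> 'a set" where
  "attr_deriv L m = {y \<in> join_irreducibles L. y \<sqsubseteq>\<^bsub>L\<^esub> m}"

definition down_arrow :: "('a, 'b) gorder_scheme \<Rightarrow> 'a \<Rightarrow> 'a \<Rightarrow> bool" where
  "down_arrow L g m \<longleftrightarrow> g \<in> join_irreducibles L \<and> m \<in> meet_irreducibles L \<and>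
     \<not> g \<sqsubseteq>\<^bsub>L\<^esub> m \<and>
     (\<forall>h \<in> join_irreducibles L. obj_deriv L g \<subset> obj_deriv L h \<longrightarrow> h \<sqsubseteq>\<^bsub>L\<^esub> m)"

definition up_arrow :: "('a, 'b) gorder_scheme \<Rightarrow> 'a \<Rightarrow> 'a \<Rightarrow> bool" where
  "up_arrow L g m \<longleftrightarrow> g \<in> join_irreducibles L \<and> m \<in> meet_irreducibles L \<and>
     \<not> g \<sqsubseteq>\<^bsub>L\<^esub> m \<and>
     (\<forall>y \<in> meet_irreducibles L. attr_deriv L m \<subset> attr_deriv L y \<longrightarrow> g \<sqsubseteq>\<^bsub>L\<^esub> y)"

section \<open>Partitions under dominance\<close>

text \<open>A partition of \<open>n\<close> is a list of length exactly \<open>n\<close>, trailing zeros included.\<close>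

definition partitions :: "nat \<Rightarrow> nat list set" where
  "partitions n = {a. length a = n \<and> sorted_wrt (\<ge>) a \<and> sum_list a = n}"

definition dominated :: "nat \<Rightarrow> nat list \<Rightarrow> nat list \<Rightarrow> bool" where
  "dominated n a b \<longleftrightarrow> (\<forall>j \<in> {1..n}. sum_list (take j a) \<le> sum_list (take j b))"

definition partition_lattice :: "nat \<Rightarrow> nat list gorder" where
  "partition_lattice n = \<lparr>carrier = partitions n, eq = (=), le = dominated n\<rparr>"

text \<open>The length-\<open>n\<close> form of a tuple written without its trailing zeros, for tuples with at most
  \<open>n\<close> entries.\<close>

definition pad :: "nat \<Rightarrow> nat list \<Rightarrow> nat list" where
  "pad n xs = xs @ replicate (n - length xs) 0"

definition type_A :: "nat \<Rightarrow> nat list \<Rightarrow> bool" where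
  "type_A n g \<longleftrightarrow> g \<in> partitions n \<and>
     (\<exists>k l. 2 \<le> k \<and> 1 \<le> l \<and> g = pad n (replicate l k))"

definition type_B :: "nat \<Rightarrow> nat list \<Rightarrow> bool" where
  "type_B n g \<longleftrightarrow> g \<in> partitions n \<and>
     (\<exists>k b l. 2 \<le> k \<and> 1 \<le> b \<and> 1 \<le> l \<and> g = pad n (replicate b k @ replicate l (k - 1)))"

end

(* In a finite lattice every element is the join of the join-irreducibles below it and the meet of
   the meet-irreducibles above it.  Hence g and m are related by both arrows iff g is not below m,
   everything strictly below g is below m, and everything strictly above m is above g.

   Put s = b + l.  The partition g is the most balanced one with at most s parts, so it is the least
   partition with at most s parts, and m is the greatest partition with more than s parts.  Since
   every partition either has at most s parts, and is then above g, or is below m, the pair (g, m)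
   splits the lattice into the filter above g and the ideal below m.  This gives both arrows.
   Conversely, if g and m' are related by the arrows, then m' is not above g, so it is below m;
   if it were strictly below m, then g would be below m. *)

theory Submission
  imports Defs "HOL-Algebra.Complete_Lattice"
begin

section \<open>Arrow relations in finite lattices\<close>

lemma least_inv_gorder: "least (inv_gorder L) x A = greatest L x A"
  by (simp add: least_def greatest_def)

lemma join_irreducibles_inv_gorder: "join_irreducibles (inv_gorder L) = meet_irreducibles L"
  by (simp add: join_irreducibles_def meet_irreducibles_def least_inv_gorder)

lemma meet_irreducibles_inv_gorder: "meet_irreducibles (inv_gorder L) = join_irreducibles L"
  by (simp add: join_irreducibles_def meet_irreducibles_def)

lemma attr_deriv_inv_gorder: "attr_deriv (inv_gorder L) m = obj_deriv L m"
  by (simp add: attr_deriv_def obj_deriv_def join_irreducibles_inv_gorder)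

lemma up_arrow_inv_gorder: "up_arrow (inv_gorder L) m g = down_arrow L g m"
  by (auto simp: up_arrow_def down_arrow_def attr_deriv_inv_gorder
      join_irreducibles_inv_gorder meet_irreducibles_inv_gorder)

text \<open>A minimal element among those below \<open>x\<close> but not below \<open>y\<close> is
  join-irreducible: if it were the join of two other elements, both would be strictly smaller, hence
  below \<open>y\<close>, and so would be their join.\<close>

lemma join_irreducible_between:
  assumes "lattice L" and fin: "finite (carrier L)"
    and x: "x \<in> carrier L" and y: "y \<in> carrier L" and nle: "\<not> x \<sqsubseteq>\<^bsub>L\<^esub> y"
  shows "\<exists>h \<in> join_irreducibles L. h \<sqsubseteq>\<^bsub>L\<^esub> x \<and> \<not> h \<sqsubseteq>\<^bsub>L\<^esub> y"
proof -
  interpret lattice L by fact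
  let ?S = "{h \<in> carrier L. h \<sqsubseteq>\<^bsub>L\<^esub> x \<and> \<not> h \<sqsubseteq>\<^bsub>L\<^esub> y}"
  \<comment> \<open>In a finite poset the size of the principal ideal is strictly monotone, so an
    element of \<open>?S\<close> with the smallest ideal is minimal in \<open>?S\<close>.\<close>
  let ?down = "\<lambda>h. card {z \<in> carrier L. z \<sqsubseteq>\<^bsub>L\<^esub> h}"
  have "x \<in> ?S" using x nle by simp
  then obtain h where h: "h \<in> ?S" and hmin: "\<And>z. z \<in> ?S \<Longrightarrow> ?down h \<le> ?down z"
    using ex_has_least_nat[of "\<lambda>h. h \<in> ?S" x ?down] by auto
  have min: "z \<sqsubseteq>\<^bsub>L\<^esub> y" if z: "z \<in> carrier L" "z \<sqsubseteq>\<^bsub>L\<^esub> h" "z \<noteq> h" for z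
  proof (rule ccontr)
    assume "\<not> z \<sqsubseteq>\<^bsub>L\<^esub> y"
    then have "z \<in> ?S" using z h x le_trans by blast
    moreover have "?down z < ?down h"
    proof (rule psubset_card_mono)
      show "{w \<in> carrier L. w \<sqsubseteq>\<^bsub>L\<^esub> z} \<subset> {w \<in> carrier L. w \<sqsubseteq>\<^bsub>L\<^esub> h}"
      proof
        show "{w \<in> carrier L. w \<sqsubseteq>\<^bsub>L\<^esub> z} \<subseteq> {w \<in> carrier L. w \<sqsubseteq>\<^bsub>L\<^esub> h}"
          using z h le_trans by blast
        have "\<not> h \<sqsubseteq>\<^bsub>L\<^esub> z" using z h le_antisym by blast
        then show "{w \<in> carrier L. w \<sqsubseteq>\<^bsub>L\<^esub> z} \<noteq> {w \<in> carrier L. w \<sqsubseteq>\<^bsub>L\<^esub> h}"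
          using h by blast
      qed
    qed (use fin in simp)
    ultimately show False using hmin by fastforce
  qed
  have "h \<in> join_irreducibles L"
    unfolding join_irreducibles_def
  proof (intro CollectI conjI ballI impI)
    show "h \<in> carrier L" using h by simp
    \<comment> \<open>The least element would lie below \<open>y\<close>.\<close>
    show "\<not> least L h (carrier L)" using h y by (auto simp: least_def)
    fix u v assume u: "u \<in> carrier L" and v: "v \<in> carrier L" and eq: "h = u \<squnion>\<^bsub>L\<^esub> v"
    show "h = u \<or> h = v"
    proof (rule ccontr)
      assume ne: "\<not> (h = u \<or> h = v)"
      have "u \<sqsubseteq>\<^bsub>L\<^esub> y" using min[of u] u v ne eq join_left by auto
      moreover have "v \<sqsubseteq>\<^bsub>L\<^esub> y" using min[of v] u v ne eq join_right by auto
      ultimately have "h \<sqsubseteq>\<^bsub>L\<^esub> y" using eq u v y join_le by simp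
      then show False using h by simp
    qed
  qed
  then show ?thesis using h by blast
qed

text \<open>If \<open>g\<close> were the join of two elements different from \<open>g\<close>, both
  would be below \<open>m\<close> by \<open>below\<close>, and hence \<open>g\<close> as well. The
  same failure of \<open>g\<close> below \<open>m\<close> keeps \<open>g\<close> from being
  least.\<close>

lemma join_irreducible_if_splits:
  assumes "lattice L" and g: "g \<in> carrier L" and m: "m \<in> carrier L" and nle: "\<not> g \<sqsubseteq>\<^bsub>L\<^esub> m"
    and below: "\<And>x. \<lbrakk>x \<in> carrier L; x \<sqsubseteq>\<^bsub>L\<^esub> g; x \<noteq> g\<rbrakk> \<Longrightarrow> x \<sqsubseteq>\<^bsub>L\<^esub> m"
  shows "g \<in> join_irreducibles L"
proof -
  interpret lattice L by fact
  show ?thesis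
    unfolding join_irreducibles_def
  proof (intro CollectI conjI ballI impI)
    show "g \<in> carrier L" by fact
    show "\<not> least L g (carrier L)" using m nle by (auto simp: least_def)
    fix u v assume u: "u \<in> carrier L" and v: "v \<in> carrier L" and eq: "g = u \<squnion>\<^bsub>L\<^esub> v"
    show "g = u \<or> g = v"
    proof (rule ccontr)
      assume ne: "\<not> (g = u \<or> g = v)"
      have "u \<sqsubseteq>\<^bsub>L\<^esub> m" using below[of u] u v ne eq join_left by auto
      moreover have "v \<sqsubseteq>\<^bsub>L\<^esub> m" using below[of v] u v ne eq join_right by auto
      ultimately show False using nle eq u v m join_le by simp
    qed
  qed
qed

text \<open>By \<open>join_irreducible_between\<close>, \<open>attr_deriv\<close> embeds the lattice
  into the subsets of its join-irreducibles. Proper inclusion of derivations is thus the strict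
  order, and the arrow can be handled without derivations.\<close>

lemma up_arrow_iff:
  assumes "lattice L" and fin: "finite (carrier L)"
    and g: "g \<in> join_irreducibles L" and m: "m \<in> meet_irreducibles L"
  shows "up_arrow L g m \<longleftrightarrow> \<not> g \<sqsubseteq>\<^bsub>L\<^esub> m \<and>
    (\<forall>y \<in> meet_irreducibles L. m \<sqsubseteq>\<^bsub>L\<^esub> y \<and> y \<noteq> m \<longrightarrow> g \<sqsubseteq>\<^bsub>L\<^esub> y)"
proof -
  interpret lattice L by fact
  have J: "h \<in> carrier L" if "h \<in> join_irreducibles L" for h
    using that by (simp add: join_irreducibles_def)
  have M: "y \<in> carrier L" if "y \<in> meet_irreducibles L" for y
    using that by (simp add: meet_irreducibles_def)
  have mono: "attr_deriv L x \<subseteq> attr_deriv L y \<longleftrightarrow> x \<sqsubseteq>\<^bsub>L\<^esub> y"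
    if "x \<in> carrier L" "y \<in> carrier L" for x y
  proof
    show "attr_deriv L x \<subseteq> attr_deriv L y \<Longrightarrow> x \<sqsubseteq>\<^bsub>L\<^esub> y"
      using join_irreducible_between[OF \<open>lattice L\<close> fin that] unfolding attr_deriv_def by blast
    show "x \<sqsubseteq>\<^bsub>L\<^esub> y \<Longrightarrow> attr_deriv L x \<subseteq> attr_deriv L y"
      using that J le_trans by (auto simp: attr_deriv_def)
  qed
  have "attr_deriv L m \<subset> attr_deriv L y \<longleftrightarrow> m \<sqsubseteq>\<^bsub>L\<^esub> y \<and> y \<noteq> m"
    if "y \<in> meet_irreducibles L" for y
    using mono[OF M[OF m] M[OF that]] mono[OF M[OF that] M[OF m]] M[OF m] M[OF that] le_antisym
    unfolding less_le_not_le by blast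
  then show ?thesis
    using g m by (auto simp: up_arrow_def)
qed

lemma up_arrow_if_splits:
  assumes L: "lattice L" and fin: "finite (carrier L)"
    and g: "g \<in> carrier L" and m: "m \<in> carrier L" and nle: "\<not> g \<sqsubseteq>\<^bsub>L\<^esub> m"
    and below: "\<And>x. \<lbrakk>x \<in> carrier L; x \<sqsubseteq>\<^bsub>L\<^esub> g; x \<noteq> g\<rbrakk> \<Longrightarrow> x \<sqsubseteq>\<^bsub>L\<^esub> m"
    and above: "\<And>x. \<lbrakk>x \<in> carrier L; m \<sqsubseteq>\<^bsub>L\<^esub> x; x \<noteq> m\<rbrakk> \<Longrightarrow> g \<sqsubseteq>\<^bsub>L\<^esub> x"
  shows "up_arrow L g m"
proof -
  have "g \<in> join_irreducibles L"
    using join_irreducible_if_splits[OF L g m nle below] .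
  \<comment> \<open>In the dual lattice \<open>m\<close> and \<open>g\<close> change places, and
    \<open>above\<close> becomes the hypothesis \<open>below\<close>.\<close>
  moreover have "m \<in> meet_irreducibles L"
    using join_irreducible_if_splits[OF lattice.dual_lattice[OF L], of m g] g m nle above
    by (auto simp: join_irreducibles_inv_gorder)
  ultimately show ?thesis
    using up_arrow_iff[OF L fin] nle above by (simp add: meet_irreducibles_def)
qed

lemma down_arrow_if_splits:
  assumes L: "lattice L" and "finite (carrier L)"
    and "g \<in> carrier L" and "m \<in> carrier L" and "\<not> g \<sqsubseteq>\<^bsub>L\<^esub> m"
    and "\<And>x. \<lbrakk>x \<in> carrier L; x \<sqsubseteq>\<^bsub>L\<^esub> g; x \<noteq> g\<rbrakk> \<Longrightarrow> x \<sqsubseteq>\<^bsub>L\<^esub> m"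
    and "\<And>x. \<lbrakk>x \<in> carrier L; m \<sqsubseteq>\<^bsub>L\<^esub> x; x \<noteq> m\<rbrakk> \<Longrightarrow> g \<sqsubseteq>\<^bsub>L\<^esub> x"
  shows "down_arrow L g m"
  using up_arrow_if_splits[OF lattice.dual_lattice[OF L], of m g] assms
  by (simp add: up_arrow_inv_gorder)

section \<open>The lattice of partitions\<close>

lemma partial_sum_lower_bound:
  fixes xs :: "nat list"
  assumes "i \<le> j" "j \<le> length xs" "\<And>t. \<lbrakk>i \<le> t; t < j\<rbrakk> \<Longrightarrow> c \<le> xs ! t"
  shows "sum_list (take i xs) + (j - i) * c \<le> sum_list (take j xs)"
  using assms
proof (induction j rule: dec_induct)
  case (step j)
  then have "sum_list (take i xs) + (j - i) * c + c \<le> sum_list (take j xs) + xs ! j"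
    by (intro add_mono) auto
  then show ?case
    using step by (simp add: take_Suc_conv_app_nth Suc_diff_le)
qed simp

lemma partial_sum_upper_bound:
  fixes xs :: "nat list"
  assumes "i \<le> j" "j \<le> length xs" "\<And>t. \<lbrakk>i \<le> t; t < j\<rbrakk> \<Longrightarrow> xs ! t \<le> c"
  shows "sum_list (take j xs) \<le> sum_list (take i xs) + (j - i) * c"
  using assms
proof (induction j rule: dec_induct)
  case (step j)
  then have "sum_list (take j xs) + xs ! j \<le> sum_list (take i xs) + (j - i) * c + c"
    by (intro add_mono) auto
  then show ?case
    using step by (simp add: take_Suc_conv_app_nth Suc_diff_le)
qed simp

lemma partial_sum_mono:
  fixes xs :: "nat list"
  assumes "i \<le> j" "j \<le> length xs"
  shows "sum_list (take i xs) \<le> sum_list (take j xs)"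
  using partial_sum_lower_bound[OF assms, of 0] by simp

lemma partitions_nth_mono:
  assumes "x \<in> partitions n" "i \<le> j" "j < n"
  shows "x ! j \<le> x ! i"
  using assms sorted_wrt_nth_less[of "(\<ge>)" x i j] by (cases "i = j") (auto simp: partitions_def)

text \<open>Empty sums agree, so the index 0 may be added; this removes a case distinction from
  later uses.\<close>

lemma dominated_iff:
  "dominated n x y \<longleftrightarrow> (\<forall>j\<le>n. sum_list (take j x) \<le> sum_list (take j y))"
proof -
  have "j \<in> {1..n} \<longleftrightarrow> j \<le> n \<and> j \<noteq> 0" for j by auto
  then show ?thesis by (metis dominated_def le_refl take0)
qed

text \<open>Entries are differences of consecutive partial sums. This yields antisymmetry of
  dominance.\<close>

lemma partitions_eqI:
  assumes x: "x \<in> partitions n" and y: "y \<in> partitions n"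
    and eq: "\<And>j. j \<le> n \<Longrightarrow> sum_list (take j x) = sum_list (take j y)"
  shows "x = y"
proof (rule nth_equalityI)
  show "length x = length y" using x y by (simp add: partitions_def)
  fix i assume "i < length x"
  then have "i < length x" "i < length y" "Suc i \<le> n" using x y by (auto simp: partitions_def)
  then show "x ! i = y ! i"
    using eq[of i] eq[of "Suc i"] by (simp add: take_Suc_conv_app_nth)
qed

lemma finite_partitions: "finite (partitions n)"
proof (rule finite_subset)
  show "partitions n \<subseteq> {xs. set xs \<subseteq> {..n} \<and> length xs = n}"
    using member_le_sum_list by (fastforce simp: partitions_def)
  show "finite {xs. set xs \<subseteq> {..n} \<and> length xs = n}"
    by (rule finite_lists_length_eq) simp
qed

text \<open>Partitions are encoded by their partial sums: the increments of a monotone concave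
  sequence from 0 to \<open>n\<close> are nonnegative and weakly decreasing. Concavity is stated
  additively to avoid truncated subtraction.\<close>

lemma partition_of_partial_sums:
  fixes S :: "nat \<Rightarrow> nat"
  assumes "S 0 = 0" "S n = n"
    and mono: "\<And>j. j < n \<Longrightarrow> S j \<le> S (Suc j)"
    and concave: "\<And>j. Suc j < n \<Longrightarrow> S j + S (Suc (Suc j)) \<le> 2 * S (Suc j)"
  shows "\<exists>a \<in> partitions n. \<forall>j\<le>n. sum_list (take j a) = S j"
proof -
  define a where "a = map (\<lambda>j. S (Suc j) - S j) [0..<n]"
  have sums: "sum_list (take j a) = S j" if "j \<le> n" for j
    using that
  proof (induction j)
    case (Suc j)
    \<comment> \<open>Monotonicity ensures that the subtraction defining the entry does not
      truncate.\<close>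
    then show ?case using mono[of j] by (simp add: a_def take_Suc_conv_app_nth)
  qed (use assms in simp)
  have "sorted_wrt (\<ge>) a"
    unfolding sorted_wrt_iff_nth_Suc_transp[OF transp_on_ge]
  proof (intro allI impI)
    fix i assume "Suc i < length a"
    then have "Suc i < n" "i < n" by (simp_all add: a_def)
    then show "a ! i \<ge> a ! Suc i"
      using concave[of i] mono[of i] mono[of "Suc i"] by (simp add: a_def)
  qed
  moreover have "length a = n" by (simp add: a_def)
  moreover from this have "sum_list a = n" using sums[of n] \<open>S n = n\<close> by simp
  ultimately show ?thesis using sums by (auto simp: partitions_def)
qed

lemma partition_partial_sums_concave:
  assumes x: "x \<in> partitions n" and "Suc j < n"
  shows "sum_list (take j x) + sum_list (take (Suc (Suc j)) x) \<le> 2 * sum_list (take (Suc j) x)"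
  using partitions_nth_mono[OF x, of j "Suc j"] assms
  by (simp add: partitions_def take_Suc_conv_app_nth)

text \<open>A pointwise minimum of monotone concave sequences is again monotone and concave, so it
  is the sequence of partial sums of a partition, which is the infimum.\<close>

lemma partitions_exists_infimum:
  assumes A: "A \<subseteq> partitions n" "A \<noteq> {}"
  obtains i where "i \<in> partitions n" "\<And>x. x \<in> A \<Longrightarrow> dominated n i x"
    "\<And>z. (\<And>x. x \<in> A \<Longrightarrow> dominated n z x) \<Longrightarrow> dominated n z i"
proof -
  define S where "S = (\<lambda>j. INF x\<in>A. sum_list (take j x))"
  have le: "S j \<le> sum_list (take j x)" if "x \<in> A" for j x
    unfolding S_def using that by (intro cINF_lower) auto
  have attained: "\<exists>x\<in>A. S j = sum_list (take j x)" for j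
    using Inf_nat_def1[of "(\<lambda>x. sum_list (take j x)) ` A"] A(2) unfolding S_def by auto
  have "\<exists>i \<in> partitions n. \<forall>j\<le>n. sum_list (take j i) = S j"
  proof (rule partition_of_partial_sums)
    show "S 0 = 0" using attained[of 0] by simp
    show "S n = n" using attained[of n] A(1) by (auto simp: partitions_def)
  next
    fix j assume "j < n"
    obtain x where x: "x \<in> A" "S (Suc j) = sum_list (take (Suc j) x)" using attained by blast
    then show "S j \<le> S (Suc j)"
      using le[of x j] partial_sum_mono[of j "Suc j" x] A(1) \<open>j < n\<close> by (auto simp: partitions_def)
  next
    fix j assume "Suc j < n"
    \<comment> \<open>Choose \<open>x\<close> attaining the minimum at the middle index. Its own
      concavity suffices, since at the two outer indices \<open>S\<close> is at most the partial sum
      of \<open>x\<close>.\<close>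
    obtain x where x: "x \<in> A" "S (Suc j) = sum_list (take (Suc j) x)" using attained by blast
    then show "S j + S (Suc (Suc j)) \<le> 2 * S (Suc j)"
      using le[of x j] le[of x "Suc (Suc j)"] partition_partial_sums_concave[of x n j]
        A(1) \<open>Suc j < n\<close> by fastforce
  qed
  then obtain i where i: "i \<in> partitions n" "\<And>j. j \<le> n \<Longrightarrow> sum_list (take j i) = S j"
    by blast
  show thesis
  proof
    show "i \<in> partitions n" by fact
    show "dominated n i x" if "x \<in> A" for x
      using le[OF that] i(2) by (simp add: dominated_iff)
    show "dominated n z i" if "\<And>x. x \<in> A \<Longrightarrow> dominated n z x" for z
      using that attained i(2) unfolding dominated_iff by metis
  qed
qed

lemma partitions_exists_greatest:
  obtains t where "t \<in> partitions n" "\<And>x. x \<in> partitions n \<Longrightarrow> dominated n x t"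
proof -
  \<comment> \<open>These are the partial sums of the partition with \<open>n\<close> as its first
    part and zeros after it.\<close>
  have "\<exists>t \<in> partitions n. \<forall>j\<le>n. sum_list (take j t) = (if j = 0 then 0 else n)"
    by (rule partition_of_partial_sums) auto
  then obtain t where t: "t \<in> partitions n"
    "\<And>j. j \<le> n \<Longrightarrow> sum_list (take j t) = (if j = 0 then 0 else n)"
    by blast
  have "dominated n x t" if x: "x \<in> partitions n" for x
    using t(2) partial_sum_mono[of _ n x] x by (fastforce simp: dominated_iff partitions_def)
  then show thesis using that t(1) by blast
qed

section \<open>Partitions under dominance form a lattice\<close>

lemma carrier_partition_lattice: "carrier (partition_lattice n) = partitions n"
  by (simp add: partition_lattice_def)

lemma le_partition_lattice: "x \<sqsubseteq>\<^bsub>partition_lattice n\<^esub> y \<longleftrightarrow> dominated n x y"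
  by (simp add: partition_lattice_def)

lemma partial_order_partition_lattice: "partial_order (partition_lattice n)"
proof
  fix x y assume "x \<sqsubseteq>\<^bsub>partition_lattice n\<^esub> y" "y \<sqsubseteq>\<^bsub>partition_lattice n\<^esub> x"
    "x \<in> carrier (partition_lattice n)" "y \<in> carrier (partition_lattice n)"
  then have "x = y"
    by (intro partitions_eqI)
      (auto simp: partition_lattice_def dominated_iff intro: le_antisym)
  then show "x .=\<^bsub>partition_lattice n\<^esub> y" by (simp add: partition_lattice_def)
qed (auto simp: partition_lattice_def dominated_iff intro: order_trans)

text \<open>A greatest element and infima of nonempty sets give a complete lattice. Joins thus need
  no explicit description; a pointwise maximum of concave sequences need not be concave.\<close>

lemma lattice_partition_lattice: "lattice (partition_lattice n)"
proof -
  interpret partial_order "partition_lattice n" by (rule partial_order_partition_lattice)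
  obtain t where t: "t \<in> partitions n" "\<And>x. x \<in> partitions n \<Longrightarrow> dominated n x t"
    using partitions_exists_greatest[of n] by blast
  interpret complete_lattice "partition_lattice n"
  proof (rule complete_lattice_criterion1)
    have "greatest (partition_lattice n) t (carrier (partition_lattice n))"
      using t by (simp add: greatest_def partition_lattice_def)
    then show "\<exists>t. greatest (partition_lattice n) t (carrier (partition_lattice n))" ..
  next
    fix A assume A: "A \<subseteq> carrier (partition_lattice n)" "A \<noteq> {}"
    then obtain i where "i \<in> partitions n" "\<And>x. x \<in> A \<Longrightarrow> dominated n i x"
      "\<And>z. (\<And>x. x \<in> A \<Longrightarrow> dominated n z x) \<Longrightarrow> dominated n z i"
      using partitions_exists_infimum[of A n] by (auto simp: carrier_partition_lattice)
    moreover have "Lower (partition_lattice n) A = {z \<in> partitions n. \<forall>x\<in>A. dominated n z x}"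
      using A(1) by (auto simp: Lower_def partition_lattice_def)
    ultimately have "greatest (partition_lattice n) i (Lower (partition_lattice n) A)"
      by (auto simp: greatest_def partition_lattice_def)
    then show "\<exists>i. greatest (partition_lattice n) i (Lower (partition_lattice n) A)" ..
  qed
  show ?thesis ..
qed

section \<open>Partitions with a bounded number of parts\<close>

text \<open>For \<open>s \<le> n\<close>, a partition \<open>x\<close> of \<open>n\<close> has at most \<open>s\<close> nonzero parts iff
  \<open>sum_list (take s x) = n\<close>.\<close>

lemma partial_sum_pad: "sum_list (take j (pad n xs)) = sum_list (take j xs)"
  by (simp add: pad_def sum_list_replicate)

lemma sorted_wrt_ge_replicate: "sorted_wrt (\<ge>) (replicate s (c :: nat))"
  by (induction s) auto

lemma pad_in_partitions:
  assumes "length xs \<le> n" "sorted_wrt (\<ge>) xs" "sum_list xs = n"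
  shows "pad n xs \<in> partitions n"
  using assms
  by (simp add: pad_def partitions_def sorted_wrt_append sum_list_replicate
      sorted_wrt_ge_replicate)

section \<open>Balanced partitions, with parts \<open>k + 1\<close> and \<open>k\<close>\<close>

lemma partial_sum_balanced:
  fixes b k l :: nat
  assumes "j \<le> b + l"
  shows "sum_list (take j (replicate b (k + 1) @ replicate l k)) = j * k + min j b"
proof (cases "j \<le> b")
  case False
  then have "j = b + (j - b)" by simp
  then have "j * k = b * k + (j - b) * k" by (metis add_mult_distrib)
  moreover have "min (j - b) l = j - b" using assms by simp
  ultimately show ?thesis using False by (simp add: sum_list_replicate)
qed (simp add: sum_list_replicate min_def)

lemma balanced_in_partitions:
  fixes b k l :: nat
  assumes "b + l \<le> n" "n = b * (k + 1) + l * k"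
  shows "pad n (replicate b (k + 1) @ replicate l k) \<in> partitions n"
  using assms
  by (intro pad_in_partitions)
    (auto simp: sum_list_replicate sorted_wrt_append sorted_wrt_ge_replicate)

text \<open>If \<open>y\<close> had too small a sum over its first \<open>j\<close> entries, its
  entries from index \<open>j\<close> on would be at most \<open>k\<close>, and then its first
  \<open>b + l\<close> entries could not add up to \<open>n\<close>.\<close>

lemma balanced_least:
  fixes b k l :: nat
  assumes s: "b + l \<le> n" and n: "n = b * (k + 1) + l * k"
    and y: "y \<in> partitions n" and parts: "sum_list (take (b + l) y) = n"
  shows "dominated n (pad n (replicate b (k + 1) @ replicate l k)) y"
  unfolding dominated_iff partial_sum_pad
proof (intro allI impI)
  fix j assume j: "j \<le> n"
  have len: "length y = n" using y by (simp add: partitions_def)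
  show "sum_list (take j (replicate b (k + 1) @ replicate l k)) \<le> sum_list (take j y)"
  proof (cases "j \<le> b + l")
    case False
    then have "sum_list (take j (replicate b (k + 1) @ replicate l k)) = n"
      using n by (simp add: sum_list_replicate)
    also have "\<dots> \<le> sum_list (take j y)"
      using partial_sum_mono[of "b + l" j y] False j len parts by simp
    finally show ?thesis .
  next
    case True
    show ?thesis
    proof (rule ccontr)
      assume "\<not> ?thesis"
      then have less: "sum_list (take j y) < j * k + min j b"
        using partial_sum_balanced[OF True, of k] by simp
      have small: "y ! t \<le> k" if t: "j \<le> t" "t < b + l" for t
      proof (rule ccontr)
        assume "\<not> y ! t \<le> k"
        \<comment> \<open>An entry above \<open>k\<close> at index \<open>t\<close> forces all
          earlier ones above \<open>k\<close>, so the first \<open>j\<close> entries reach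
          \<open>j * (k + 1)\<close>, contradicting \<open>less\<close>.\<close>
        then have "k + 1 \<le> y ! u" if "u < j" for u
          using partitions_nth_mono[OF y, of u t] that t s by simp
        then have "j * (k + 1) \<le> sum_list (take j y)"
          using partial_sum_lower_bound[of 0 j y "k + 1"] j len by simp
        with less show False by simp
      qed
      have "n \<le> sum_list (take j y) + (b + l - j) * k"
        using partial_sum_upper_bound[of j "b + l" y k] small True s len parts by simp
      also have "\<dots> < j * k + min j b + (b + l - j) * k" using less by simp
      also have "\<dots> \<le> (j + (b + l - j)) * k + b" by (simp add: add_mult_distrib)
      also have "\<dots> = n" using True n by (simp add: algebra_simps)
      finally show False by simp
    qed
  qed
qed

section \<open>Hooks: one arbitrary part followed by ones\<close>

lemma partial_sum_hook:
  assumes "0 < j"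
  shows "sum_list (take j (c # replicate s 1)) = c + min (j - 1) s"
  using assms by (cases j) (simp_all add: sum_list_replicate)

lemma hook_in_partitions:
  assumes "s < n"
  shows "pad n ((n - s) # replicate s 1) \<in> partitions n"
  using assms
  by (intro pad_in_partitions)
    (auto simp: sum_list_replicate sorted_wrt_ge_replicate)

text \<open>With more than \<open>s\<close> parts, the first \<open>s + 1\<close> entries are all
  positive. For \<open>j\<close> at most \<open>s + 1\<close>, at least \<open>s + 1 - j\<close>
  must therefore be left for the entries after the first \<open>j\<close>, and the hook leaves
  exactly that; for larger \<open>j\<close> its partial sum is already \<open>n\<close>.\<close>

lemma hook_greatest:
  assumes s: "s < n" and y: "y \<in> partitions n" and parts: "sum_list (take s y) \<noteq> n"
  shows "dominated n y (pad n ((n - s) # replicate s 1))"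
  unfolding dominated_def partial_sum_pad
proof
  fix j assume j: "j \<in> {1..n}"
  have len: "length y = n" and sum: "sum_list (take n y) = n"
    using y by (simp_all add: partitions_def)
  have le_n: "sum_list (take i y) \<le> n" if "i \<le> n" for i
    using partial_sum_mono[of i n y] that len sum by simp
  \<comment> \<open>Indices start at 0, so this is part number \<open>s + 1\<close>. Were it zero,
    all later parts would vanish too and the first \<open>s\<close> would sum to
    \<open>n\<close>.\<close>
  have "y ! s \<noteq> 0"
  proof
    assume "y ! s = 0"
    then have "y ! t \<le> 0" if "s \<le> t" "t < n" for t
      using partitions_nth_mono[OF y, of s t] that by simp
    then have "n \<le> sum_list (take s y)"
      using partial_sum_upper_bound[of s n y 0] s len sum by simp
    then show False using parts le_n[of s] s by simp
  qed
  then have pos: "1 \<le> y ! t" if "t \<le> s" for t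
    using partitions_nth_mono[OF y, of t s] that s by simp
  show "sum_list (take j y) \<le> sum_list (take j ((n - s) # replicate s 1))"
  proof (cases "j \<le> Suc s")
    case True
    then have "sum_list (take j y) + (Suc s - j) \<le> n"
      using partial_sum_lower_bound[of j "Suc s" y 1] pos len s le_n[of "Suc s"] by simp
    then show ?thesis using True j s by (subst partial_sum_hook) auto
  next
    case False
    then show ?thesis using le_n[of j] j s by (subst partial_sum_hook) auto
  qed
qed

lemma balanced_not_dominated_hook:
  fixes b k l :: nat
  assumes "0 < l" "b + l < n" "n = b * (k + 1) + l * k"
  shows "\<not> dominated n (pad n (replicate b (k + 1) @ replicate l k))
    (pad n ((n - (b + l)) # replicate (b + l) 1))"
proof
  assume "dominated n (pad n (replicate b (k + 1) @ replicate l k))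
    (pad n ((n - (b + l)) # replicate (b + l) 1))"
  \<comment> \<open>The partial sums are compared at \<open>b + l\<close>: the balanced partition
    has reached \<open>n\<close>, while the hook still lacks its last 1. Here \<open>b + l\<close>
    is positive because \<open>l\<close> is.\<close>
  then have "sum_list (take (b + l) (replicate b (k + 1) @ replicate l k))
      \<le> sum_list (take (b + l) ((n - (b + l)) # replicate (b + l) 1))"
    using assms(2) by (simp only: dominated_iff partial_sum_pad)
  moreover have "sum_list (take (b + l) (replicate b (k + 1) @ replicate l k)) = n"
    using assms by (simp add: sum_list_replicate)
  moreover have "sum_list (take (b + l) ((n - (b + l)) # replicate (b + l) 1)) < n"
    using assms by (subst partial_sum_hook) auto
  ultimately show False by simp
qed

section \<open>Arrows between balanced partitions and hooks\<close>

lemma arrows_balanced_hook: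
  fixes b k l :: nat
  assumes l: "0 < l" and s: "b + l < n" and n: "n = b * (k + 1) + l * k"
  defines "g \<equiv> pad n (replicate b (k + 1) @ replicate l k)"
    and "m \<equiv> pad n ((n - (b + l)) # replicate (b + l) 1)"
  shows "down_arrow (partition_lattice n) g m" and "up_arrow (partition_lattice n) g m"
proof -
  interpret lattice "partition_lattice n" by (rule lattice_partition_lattice)
  have fin: "finite (carrier (partition_lattice n))"
    by (simp add: carrier_partition_lattice finite_partitions)
  have g: "g \<in> carrier (partition_lattice n)" and m: "m \<in> carrier (partition_lattice n)"
    unfolding g_def m_def carrier_partition_lattice
    using balanced_in_partitions[OF _ n] hook_in_partitions[OF s] s by simp_all
  have nle: "\<not> g \<sqsubseteq>\<^bsub>partition_lattice n\<^esub> m"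
    unfolding g_def m_def le_partition_lattice by (rule balanced_not_dominated_hook[OF l s n])
  \<comment> \<open>The cases are whether or not the first \<open>b + l\<close> entries of
    \<open>x\<close> sum to \<open>n\<close>.\<close>
  have split: "g \<sqsubseteq>\<^bsub>partition_lattice n\<^esub> x \<or> x \<sqsubseteq>\<^bsub>partition_lattice n\<^esub> m"
    if "x \<in> carrier (partition_lattice n)" for x
    using that balanced_least[OF _ n] hook_greatest[OF s] s
    unfolding g_def m_def carrier_partition_lattice le_partition_lattice by (meson less_imp_le)
  \<comment> \<open>By antisymmetry an \<open>x\<close> strictly below \<open>g\<close> is not above
    \<open>g\<close>, so \<open>split\<close> puts it below \<open>m\<close>; \<open>above\<close>
    is dual.\<close>
  have below: "x \<sqsubseteq>\<^bsub>partition_lattice n\<^esub> m"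
    if "x \<in> carrier (partition_lattice n)" "x \<sqsubseteq>\<^bsub>partition_lattice n\<^esub> g" "x \<noteq> g" for x
    using split that g le_antisym by blast
  have above: "g \<sqsubseteq>\<^bsub>partition_lattice n\<^esub> x"
    if "x \<in> carrier (partition_lattice n)" "m \<sqsubseteq>\<^bsub>partition_lattice n\<^esub> x" "x \<noteq> m" for x
    using split that m le_antisym by blast
  show "down_arrow (partition_lattice n) g m"
    by (rule down_arrow_if_splits[OF lattice_partition_lattice fin g m nle below above])
  show "up_arrow (partition_lattice n) g m"
    by (rule up_arrow_if_splits[OF lattice_partition_lattice fin g m nle below above])
qed

lemma up_arrow_balanced_unique:
  fixes b k l :: nat
  assumes l: "0 < l" and s: "b + l < n" and n: "n = b * (k + 1) + l * k"
    and up: "up_arrow (partition_lattice n) (pad n (replicate b (k + 1) @ replicate l k)) m"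
  shows "m = pad n ((n - (b + l)) # replicate (b + l) 1)"
proof (rule ccontr)
  let ?g = "pad n (replicate b (k + 1) @ replicate l k)"
  let ?m = "pad n ((n - (b + l)) # replicate (b + l) 1)"
  assume ne: "m \<noteq> ?m"
  have up': "up_arrow (partition_lattice n) ?g ?m"
    by (rule arrows_balanced_hook[OF l s n])
  have fin: "finite (carrier (partition_lattice n))"
    by (simp add: carrier_partition_lattice finite_partitions)
  have irr: "?g \<in> join_irreducibles (partition_lattice n)"
    "m \<in> meet_irreducibles (partition_lattice n)"
    "?m \<in> meet_irreducibles (partition_lattice n)"
    and nle: "\<not> dominated n ?g m" "\<not> dominated n ?g ?m"
    using up up' by (simp_all add: up_arrow_def le_partition_lattice)
  have "m \<in> partitions n"
    using irr by (simp add: meet_irreducibles_def carrier_partition_lattice)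
  then have "dominated n m ?m"
    using balanced_least[OF _ n] hook_greatest[OF s] s nle(1) by (meson less_imp_le)
  \<comment> \<open>The hook \<open>?m\<close> is a meet-irreducible strictly above
    \<open>m\<close>, so the up arrow from \<open>?g\<close> to \<open>m\<close> applies to
    it.\<close>
  then have "dominated n ?g ?m"
    using up irr(3) ne
    unfolding up_arrow_iff[OF lattice_partition_lattice fin irr(1,2)]
    by (auto simp: le_partition_lattice)
  then show False using nle by simp
qed

text \<open>Both types take one common shape: type A is the case \<open>b = 0\<close>, and in type B
  the smaller part \<open>k - 1\<close> takes the role of \<open>k\<close>. Some part is at least 2,
  which gives \<open>b + l < n\<close>.\<close>

lemma balanced_if_type_A_or_B:
  assumes "type_A n g \<or> type_B n g"
  obtains b k l :: nat where "0 < k" "0 < l" "b + l < n" "n = b * (k + 1) + l * k"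
    "g = pad n (replicate b (k + 1) @ replicate l k)"
  using assms
proof
  assume "type_A n g"
  then obtain k l where g: "g \<in> partitions n" "2 \<le> k" "1 \<le> l" "g = pad n (replicate l k)"
    by (auto simp: type_A_def)
  then have "n = l * k" by (simp add: partitions_def pad_def sum_list_replicate)
  moreover from this have "l < n" using g by simp
  ultimately show thesis using g by (intro that[of k l 0]) auto
next
  assume "type_B n g"
  then obtain k b l where g: "g \<in> partitions n" "2 \<le> k" "1 \<le> b" "1 \<le> l"
    "g = pad n (replicate b k @ replicate l (k - 1))"
    by (auto simp: type_B_def)
  then have n: "n = b * (k - 1 + 1) + l * (k - 1)"
    by (simp add: partitions_def pad_def sum_list_replicate)
  moreover have "b + l < b * (k - 1 + 1) + l * (k - 1)"
    using g by (intro add_less_le_mono) auto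
  ultimately show thesis using g by (intro that[of "k - 1" l b]) auto
qed

lemma type_A_or_B_if_balanced:
  fixes b k l :: nat
  assumes k: "0 < k" and l: "0 < l" and s: "b + l < n" and n: "n = b * (k + 1) + l * k"
  defines "g \<equiv> pad n (replicate b (k + 1) @ replicate l k)"
  shows "b = 0 \<Longrightarrow> type_A n g" and "1 \<le> b \<Longrightarrow> type_B n g"
proof -
  have g: "g \<in> partitions n"
    unfolding g_def using s n by (intro balanced_in_partitions) auto
  show "type_A n g" if "b = 0"
  proof -
    \<comment> \<open>For \<open>b = 0\<close> and \<open>k = 1\<close> one would have
      \<open>n = l\<close>, against \<open>b + l < n\<close>.\<close>
    have "1 < k" using s n k l that by (cases "k = 1") auto
    then have "2 \<le> k \<and> 1 \<le> l \<and> g = pad n (replicate l k)"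
      using l that by (simp add: g_def)
    with g show ?thesis unfolding type_A_def by blast
  qed
  show "type_B n g" if "1 \<le> b"
  proof -
    have "2 \<le> k + 1 \<and> 1 \<le> b \<and> 1 \<le> l \<and> g = pad n (replicate b (k + 1) @ replicate l (k + 1 - 1))"
      using k l that by (simp add: g_def)
    with g show ?thesis unfolding type_B_def by blast
  qed
qed

theorem theorem4p10:
  fixes n :: nat
  shows
    "(\<forall>b k l a :: nat. \<forall>g m :: nat list.
        0 < k \<and> 0 < l \<and> 0 < n \<and> b + l < n \<and> n = b * (k + 1) + l * k \<and> a = n - b - l \<and>
        g = pad n (replicate b (k + 1) @ replicate l k) \<and>
        m = pad n (a # replicate (b + l) 1)
        \<longrightarrow> g \<in> join_irreducibles (partition_lattice n) \<and>
            (b = 0 \<longrightarrow> type_A n g) \<and>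
            (1 \<le> b \<longrightarrow> type_B n g) \<and>
            m \<in> meet_irreducibles (partition_lattice n) \<and>
            down_arrow (partition_lattice n) g m \<and>
            up_arrow (partition_lattice n) g m)
     \<and>
     (\<forall>g m :: nat list.
        g \<in> join_irreducibles (partition_lattice n) \<and> (type_A n g \<or> type_B n g) \<and>
        m \<in> meet_irreducibles (partition_lattice n) \<and>
        down_arrow (partition_lattice n) g m \<and> up_arrow (partition_lattice n) g m
        \<longrightarrow> (\<exists>b k l :: nat.
              0 < k \<and> 0 < l \<and> b + l < n \<and> n = b * (k + 1) + l * k \<and>
              g = pad n (replicate b (k + 1) @ replicate l k) \<and>
              m = pad n ((n - b - l) # replicate (b + l) 1)))"
proof (intro conjI allI impI; elim conjE)
  fix b k l a :: nat and g m
  assume k: "0 < k" and l: "0 < l" and s: "b + l < n" and n: "n = b * (k + 1) + l * k"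
    and a: "a = n - b - l"
    and g: "g = pad n (replicate b (k + 1) @ replicate l k)"
    and m: "m = pad n (a # replicate (b + l) 1)"
  \<comment> \<open>The arrows come first because membership in the irreducibles is part of their
    definition and is read off from \<open>down\<close>.\<close>
  show down: "down_arrow (partition_lattice n) g m" and "up_arrow (partition_lattice n) g m"
    using arrows_balanced_hook[OF l s n] unfolding g m a by simp_all
  show "g \<in> join_irreducibles (partition_lattice n)"
    and "m \<in> meet_irreducibles (partition_lattice n)"
    using down by (simp_all add: down_arrow_def)
  show "type_A n g" if "b = 0"
    unfolding g using type_A_or_B_if_balanced(1)[OF k l s n that] .
  show "type_B n g" if "1 \<le> b"
    unfolding g using type_A_or_B_if_balanced(2)[OF k l s n that] .
next
  fix g m
  assume "type_A n g \<or> type_B n g" and up: "up_arrow (partition_lattice n) g m"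
  then obtain b k l :: nat where bkl: "0 < k" "0 < l" "b + l < n" "n = b * (k + 1) + l * k"
    and g: "g = pad n (replicate b (k + 1) @ replicate l k)"
    by (metis balanced_if_type_A_or_B)
  have "m = pad n ((n - b - l) # replicate (b + l) 1)"
    using up_arrow_balanced_unique[OF bkl(2-4)] up unfolding g by simp
  with bkl g show "\<exists>b k l :: nat.
      0 < k \<and> 0 < l \<and> b + l < n \<and> n = b * (k + 1) + l * k \<and>
      g = pad n (replicate b (k + 1) @ replicate l k) \<and>
      m = pad n ((n - b - l) # replicate (b + l) 1)"
    by blast
qed

end
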